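(* Let $\rho = (1+\sqrt{-3})/2$, let $0 \ne \alpha = a + b\rho \in \mathbb{Z}[\rho]$ with integers $a, b \ge 0$, and let $0 \ne \beta \in \mathbb{Z}[\rho]$ be such that $N(\alpha) \ge 7$ and $\beta$ divides $\alpha$. Let $t$ be an integer with $1 \le t \le \lfloor (a+b-1)/2 \rfloor$. Then $(\beta)/(\alpha)$ is a perfect $t$-code in the Eisenstein–Jacobi graph $EJ_\alpha$ if and only if $\beta$ is an associate of $(t+1) + t\rho$ or of $t + (t+1)\rho$.
   Context: $\mathbb{Z}[\rho] = \{x + y\rho : x,y \in \mathbb{Z}\}$ is the ring of Eisenstein–Jacobi integers, where $\rho^2 - \rho + 1 = 0$, with norm $N(x+y\rho) = x^2 + xy + y^2$; its units are $\pm\rho^j$, and two elements are associates if one is $\rho^j$ times the other for some integer $j$. The Eisenstein–Jacobi graph $EJ_\alpha$ is the Cayley graph on the additive group of $\mathbb{Z}[\rho]/(\alpha)$ with connection set $\{\pm(1 + (\alpha)), \pm(\rho + (\alpha)), \pm(\rho^2 + (\alpha))\}$, i.e. $x,y$ adjacent iff $x-y$ lies in this set. $(\beta)/(\alpha) = \{\gamma + (\alpha) : \gamma \in (\beta)\}$. A perfect $t$-code in a graph is a nonempty vertex subset $C$ such that the balls of radius $t$ (in graph distance) centred at the vertices of $C$ partition the vertex set. *)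

theory Defs
  imports
    Complex_Main
    "HOL-Library.Disjoint_Sets"
    "Graph_Theory.Graph_Theory"
    "HOL-Algebra.Divisibility"
    "HOL-Algebra.QuotRing"
begin

definition ej_rho :: complex (\<open>\<rho>\<close>)
  where "\<rho> = (1 + csqrt (- 3)) / 2"

definition EJ_ring :: "complex ring" (\<open>\<int>[\<rho>]\<close>)
  where "\<int>[\<rho>] = \<lparr>carrier = {of_int x + of_int y * \<rho> | x y. True},
    monoid.mult = (*), one = 1, zero = 0, add = (+)\<rparr>"

text \<open>The norm is read off from the coordinates, which are unique; see
  \<open>ej_norm_eq\<close> below.\<close>

definition ej_norm :: "complex \<Rightarrow> int"
  where "ej_norm z = (THE n. \<exists>x y. z = of_int x + of_int y * \<rho> \<and> n = x\<^sup>2 + x * y + y\<^sup>2)"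

definition ej_associate :: "complex \<Rightarrow> complex \<Rightarrow> bool"
  where "ej_associate z w \<longleftrightarrow> (\<exists>j::int. z = \<rho> powi j * w)"

definition cayley_graph :: "('a, 'b) monoid_scheme \<Rightarrow> 'a set \<Rightarrow> ('a, 'a \<times> 'a) pre_digraph"
  where "cayley_graph G S = with_proj
    \<lparr>pverts = carrier G,
     parcs = {(x, y). x \<in> carrier G \<and> y \<in> carrier G \<and> x \<otimes>\<^bsub>G\<^esub> inv\<^bsub>G\<^esub> y \<in> S}\<rparr>"

text \<open>With unit arc costs, \<open>wf_digraph.\<mu>\<close> is the length of a shortest walk (and \<open>\<infinity>\<close> if
  there is none).\<close>

definition graph_ball :: "('a, 'b) pre_digraph \<Rightarrow> nat \<Rightarrow> 'a \<Rightarrow> 'a set"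
  where "graph_ball G t c = {v \<in> verts G. wf_digraph.\<mu> G (\<lambda>_. 1) c v \<le> ereal (real t)}"

text \<open>Disjointness is required of the family indexed by the centres: distinct centres
  with equal balls are not allowed.\<close>

definition perfect_code :: "('a, 'b) pre_digraph \<Rightarrow> nat \<Rightarrow> 'a set \<Rightarrow> bool"
  where "perfect_code G t C \<longleftrightarrow> C \<noteq> {} \<and> C \<subseteq> verts G \<and>
    disjoint_family_on (graph_ball G t) C \<and> (\<Union>c\<in>C. graph_ball G t c) = verts G"

definition EJ_quot :: "complex \<Rightarrow> complex set ring"
  where "EJ_quot \<alpha> = \<int>[\<rho>] Quot (PIdl\<^bsub>\<int>[\<rho>]\<^esub> \<alpha>)"

definition EJ_class :: "complex \<Rightarrow> complex \<Rightarrow> complex set"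
  where "EJ_class \<alpha> \<gamma> = PIdl\<^bsub>\<int>[\<rho>]\<^esub> \<alpha> +>\<^bsub>\<int>[\<rho>]\<^esub> \<gamma>"

definition EJ_connection_set :: "complex \<Rightarrow> complex set set"
  where "EJ_connection_set \<alpha> =
    (\<Union>u\<in>{1, \<rho>, \<rho>\<^sup>2}. {EJ_class \<alpha> u, \<ominus>\<^bsub>EJ_quot \<alpha>\<^esub> EJ_class \<alpha> u})"

definition EJ_graph :: "complex \<Rightarrow> (complex set, complex set \<times> complex set) pre_digraph"
  where "EJ_graph \<alpha> = cayley_graph (add_monoid (EJ_quot \<alpha>)) (EJ_connection_set \<alpha>)"

definition EJ_ideal_quot :: "complex \<Rightarrow> complex \<Rightarrow> complex set set"
  where "EJ_ideal_quot \<beta> \<alpha> = EJ_class \<alpha> ` (PIdl\<^bsub>\<int>[\<rho>]\<^esub> \<beta>)"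

lemma ej_rho_eq: "\<rho> = Complex (1 / 2) (sqrt 3 / 2)"
proof -
  have "csqrt (- 3) = \<i> * csqrt 3"
    by (simp add: csqrt_minus)
  also have "csqrt (3::complex) = of_real (sqrt 3)"
    using of_real_sqrt[of 3] by simp
  finally show ?thesis
    by (simp add: ej_rho_def complex_eq_iff)
qed

lemma ej_rho_quadratic: "\<rho>\<^sup>2 - \<rho> + 1 = 0"
  by (simp add: ej_rho_eq complex_eq_iff power2_eq_square)

lemma EJ_coords_unique:
  "of_int x + of_int y * \<rho> = of_int x' + of_int y' * \<rho> \<longleftrightarrow> x = x' \<and> y = y'"
  by (auto simp: ej_rho_eq complex_eq_iff)

lemma ej_norm_eq: "ej_norm (of_int x + of_int y * \<rho>) = x\<^sup>2 + x * y + y\<^sup>2"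
  unfolding ej_norm_def EJ_coords_unique by (rule the_equality) auto

lemma EJ_ring_carrierI: "z = of_int x + of_int y * \<rho> \<Longrightarrow> z \<in> carrier \<int>[\<rho>]"
  by (auto simp: EJ_ring_def)

lemma EJ_ring_cring: "cring \<int>[\<rho>]"
proof (rule cringI)
  show "abelian_group \<int>[\<rho>]"
  proof (rule abelian_groupI; (simp add: EJ_ring_def algebra_simps; fail)?)
    fix x y assume "x \<in> carrier \<int>[\<rho>]" "y \<in> carrier \<int>[\<rho>]"
    then obtain a b c d where "x = of_int a + of_int b * \<rho>" "y = of_int c + of_int d * \<rho>"
      by (auto simp: EJ_ring_def)
    then have "x \<oplus>\<^bsub>\<int>[\<rho>]\<^esub> y = of_int (a + c) + of_int (b + d) * \<rho>"
      by (simp add: EJ_ring_def algebra_simps)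
    then show "x \<oplus>\<^bsub>\<int>[\<rho>]\<^esub> y \<in> carrier \<int>[\<rho>]"
      by (rule EJ_ring_carrierI)
  next
    show "\<zero>\<^bsub>\<int>[\<rho>]\<^esub> \<in> carrier \<int>[\<rho>]"
      by (rule EJ_ring_carrierI[of _ 0 0]) (simp add: EJ_ring_def)
  next
    fix x assume "x \<in> carrier \<int>[\<rho>]"
    then obtain a b where x: "x = of_int a + of_int b * \<rho>"
      by (auto simp: EJ_ring_def)
    have "of_int (- a) + of_int (- b) * \<rho> \<in> carrier \<int>[\<rho>]"
      by (rule EJ_ring_carrierI) (rule refl)
    moreover have "(of_int (- a) + of_int (- b) * \<rho>) \<oplus>\<^bsub>\<int>[\<rho>]\<^esub> x = \<zero>\<^bsub>\<int>[\<rho>]\<^esub>"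
      by (simp add: x EJ_ring_def)
    ultimately show "\<exists>y\<in>carrier \<int>[\<rho>]. y \<oplus>\<^bsub>\<int>[\<rho>]\<^esub> x = \<zero>\<^bsub>\<int>[\<rho>]\<^esub>" ..
  qed
  show "comm_monoid \<int>[\<rho>]"
  proof (rule comm_monoidI; (simp add: EJ_ring_def algebra_simps; fail)?)
    fix x y assume "x \<in> carrier \<int>[\<rho>]" "y \<in> carrier \<int>[\<rho>]"
    then obtain a b c d where xy: "x = of_int a + of_int b * \<rho>" "y = of_int c + of_int d * \<rho>"
      by (auto simp: EJ_ring_def)
    have "x * y = of_int (a * c) + of_int (a * d + b * c) * \<rho> + of_int (b * d) * \<rho>\<^sup>2"
      by (simp add: xy algebra_simps power2_eq_square)
    also have "\<rho>\<^sup>2 = \<rho> - 1"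
      using ej_rho_quadratic by (simp add: algebra_simps add_eq_0_iff2)
    finally have "x * y = of_int (a * c - b * d) + of_int (a * d + b * c + b * d) * \<rho>"
      by (simp add: algebra_simps)
    then have "x \<otimes>\<^bsub>\<int>[\<rho>]\<^esub> y = of_int (a * c - b * d) + of_int (a * d + b * c + b * d) * \<rho>"
      by (simp add: EJ_ring_def)
    then show "x \<otimes>\<^bsub>\<int>[\<rho>]\<^esub> y \<in> carrier \<int>[\<rho>]"
      by (rule EJ_ring_carrierI)
  next
    show "\<one>\<^bsub>\<int>[\<rho>]\<^esub> \<in> carrier \<int>[\<rho>]"
      by (rule EJ_ring_carrierI[of _ 1 0]) (simp add: EJ_ring_def)
  qed
  show "(x \<oplus>\<^bsub>\<int>[\<rho>]\<^esub> y) \<otimes>\<^bsub>\<int>[\<rho>]\<^esub> z = x \<otimes>\<^bsub>\<int>[\<rho>]\<^esub> z \<oplus>\<^bsub>\<int>[\<rho>]\<^esub> y \<otimes>\<^bsub>\<int>[\<rho>]\<^esub> z" for x y z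
    by (simp add: EJ_ring_def algebra_simps)
qed

lemma wf_digraph_cayley_graph: "wf_digraph (cayley_graph G S)"
  by unfold_locales (auto simp: cayley_graph_def)

lemma graph_ball_cayley_graph:
  "graph_ball (cayley_graph G S) t c = {v \<in> carrier G.
     \<exists>p. pre_digraph.awalk (cayley_graph G S) c p v \<and> length p \<le> t}"
proof -
  let ?G = "cayley_graph G S"
  interpret wf_digraph ?G by (rule wf_digraph_cayley_graph)
  have cost: "awalk_cost (\<lambda>_. 1) p = real (length p)" for p :: "('a \<times> 'a) list"
    by (induction p) auto
  have "\<mu> (\<lambda>_. 1) c v \<le> ereal (real t) \<longleftrightarrow> (\<exists>p. awalk c p v \<and> length p \<le> t)" for v
  proof
    assume "\<exists>p. awalk c p v \<and> length p \<le> t"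
    then obtain p where "awalk c p v" "length p \<le> t" by blast
    then show "\<mu> (\<lambda>_. 1) c v \<le> ereal (real t)"
      unfolding \<mu>_def cost by (intro INF_lower2[of p]) auto
  next
    assume *: "\<mu> (\<lambda>_. 1) c v \<le> ereal (real t)"
    have "\<mu> (\<lambda>_. 1) c v < ereal (real t + 1)"
      using * by (rule le_less_trans) simp
    then obtain p where "awalk c p v" "real (length p) < real t + 1"
      unfolding \<mu>_def cost by (auto simp: INF_less_iff)
    then show "\<exists>p. awalk c p v \<and> length p \<le> t"
      by (intro exI[of _ p]) linarith
  qed
  moreover have "verts ?G = carrier G"
    by (simp add: cayley_graph_def)
  ultimately show ?thesis
    unfolding graph_ball_def by simp
qed

end

theory Submission
  imports Defs
begin

text \<open>In the hexagonal metric \<open>max \<bar>x\<bar> (max \<bar>y\<bar> \<bar>x + y\<bar>)\<close> let \<open>D\<^sub>t\<close> be the ball of radius \<open>t\<close>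
  around 0; graph balls in the quotient are images of translates of \<open>D\<^sub>t\<close>. Since
  \<open>2t < a + b\<close> is less than the hexagonal length of every nonzero multiple of \<open>\<alpha>\<close>, the code is
  perfect iff \<open>D\<^sub>t\<close> is a system of representatives modulo \<open>\<beta>\<close>. As \<open>\<int>[\<rho>]/(\<beta>)\<close> has \<open>N(\<beta>)\<close>
  elements and \<open>D\<^sub>t\<close> has \<open>3t\<^sup>2 + 3t + 1\<close>, this means that \<open>N(\<beta>) = 3t\<^sup>2 + 3t + 1\<close> and that
  no nonzero multiple of \<open>\<beta>\<close> has length at most \<open>2t\<close>. For \<open>\<beta>\<close> of length \<open>l\<close> one has
  \<open>4 N(\<beta>) = 3 l\<^sup>2 + q\<^sup>2\<close> with an integer \<open>q\<close>, while \<open>4 (3t\<^sup>2 + 3t + 1) = 3 (2t + 1)\<^sup>2 + 1\<close>;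
  hence \<open>l = 2t + 1\<close> and \<open>q = \<plusminus>1\<close>, which leaves exactly the stated associates.\<close>

section \<open>Units, discs and coordinate arithmetic in the ring\<close>

definition ej_units :: "complex set"
  where "ej_units = {1, - 1, \<rho>, - \<rho>, \<rho>\<^sup>2, - \<rho>\<^sup>2}"

text \<open>This is \<open>D\<^sub>n\<close> of the overview. The third quantity is
  \<open>x + y\<close> and not \<open>x - y\<close> because
  \<open>\<rho>\<^sup>2 = \<rho> - 1\<close> is a unit whereas \<open>1 + \<rho>\<close> is not:
  coordinates of opposite sign can be shortened by one common step, coordinates of equal sign
  cannot.\<close>

definition ej_disc :: "nat \<Rightarrow> complex set"
  where "ej_disc n = {of_int x + of_int y * \<rho> | x y.
    \<bar>x\<bar> \<le> int n \<and> \<bar>y\<bar> \<le> int n \<and> \<bar>x + y\<bar> \<le> int n}"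

lemma ej_rho_power2: "\<rho>\<^sup>2 = \<rho> - 1"
  using ej_rho_quadratic by (simp add: algebra_simps add_eq_0_iff2)

text \<open>The trailing factor \<open>z\<close> fits the right-nested products left by
  \<open>algebra_simps\<close>, so products reduce to coordinates by rewriting.\<close>

lemma ej_rho_mult_rho: "\<rho> * (\<rho> * z) = \<rho> * z - z"
proof -
  have "\<rho> * (\<rho> * z) = \<rho>\<^sup>2 * z"
    by (simp add: power2_eq_square)
  then show ?thesis
    by (simp add: ej_rho_power2 algebra_simps)
qed

lemma EJ_carrier_iff: "z \<in> carrier \<int>[\<rho>] \<longleftrightarrow> (\<exists>x y. z = of_int x + of_int y * \<rho>)"
  by (auto simp: EJ_ring_def)

lemma EJ_ring_simps [simp]:
  "x \<otimes>\<^bsub>\<int>[\<rho>]\<^esub> y = x * y" "x \<oplus>\<^bsub>\<int>[\<rho>]\<^esub> y = x + y" "\<zero>\<^bsub>\<int>[\<rho>]\<^esub> = 0" "\<one>\<^bsub>\<int>[\<rho>]\<^esub> = 1"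
  by (simp_all add: EJ_ring_def)

lemma EJ_mult_coords:
  "(of_int x + of_int y * \<rho>) * (of_int u + of_int v * \<rho>) =
    of_int (x * u - y * v) + of_int (x * v + y * u + y * v) * \<rho>"
  by (simp add: algebra_simps ej_rho_mult_rho)

lemma EJ_in_carrier [simp]: "of_int x + of_int y * \<rho> \<in> carrier \<int>[\<rho>]"
  by (rule EJ_ring_carrierI) (rule refl)

lemma EJ_carrier_of_int [simp]: "of_int x \<in> carrier \<int>[\<rho>]"
  using EJ_in_carrier[of x 0] by simp

lemma EJ_carrier_rho [simp]: "\<rho> \<in> carrier \<int>[\<rho>]"
  using EJ_in_carrier[of 0 1] by simp

lemma EJ_carrier_zero_one [simp]: "0 \<in> carrier \<int>[\<rho>]" "1 \<in> carrier \<int>[\<rho>]"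
  using EJ_carrier_of_int[of 0] EJ_carrier_of_int[of 1] by simp_all

lemma EJ_carrier_add [simp]:
  "x \<in> carrier \<int>[\<rho>] \<Longrightarrow> y \<in> carrier \<int>[\<rho>] \<Longrightarrow> x + y \<in> carrier \<int>[\<rho>]"
  using cring.cring_simprules(1)[OF EJ_ring_cring] by simp

lemma EJ_carrier_mult [simp]:
  "x \<in> carrier \<int>[\<rho>] \<Longrightarrow> y \<in> carrier \<int>[\<rho>] \<Longrightarrow> x * y \<in> carrier \<int>[\<rho>]"
  using cring.cring_simprules(5)[OF EJ_ring_cring] by simp

lemma EJ_carrier_uminus [simp]: "x \<in> carrier \<int>[\<rho>] \<Longrightarrow> - x \<in> carrier \<int>[\<rho>]"
  using EJ_carrier_mult[OF EJ_carrier_of_int[of "- 1"]] by simp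

lemma EJ_carrier_diff [simp]:
  "x \<in> carrier \<int>[\<rho>] \<Longrightarrow> y \<in> carrier \<int>[\<rho>] \<Longrightarrow> x - y \<in> carrier \<int>[\<rho>]"
  using EJ_carrier_add[OF _ EJ_carrier_uminus, of x y] by simp

lemma EJ_a_inv [simp]: "x \<in> carrier \<int>[\<rho>] \<Longrightarrow> \<ominus>\<^bsub>\<int>[\<rho>]\<^esub> x = - x"
  using abelian_group.minus_equality[of "\<int>[\<rho>]" "- x" x]
    ring.is_abelian_group[OF cring.axioms(1)[OF EJ_ring_cring]] by simp

lemma EJ_carrier_power [simp]: "x \<in> carrier \<int>[\<rho>] \<Longrightarrow> x ^ n \<in> carrier \<int>[\<rho>]"
  by (induction n) simp_all

lemma ej_units_carrier [simp]: "u \<in> ej_units \<Longrightarrow> u \<in> carrier \<int>[\<rho>]"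
  unfolding ej_units_def by (elim insertE emptyE) simp_all

lemma ej_disc_carrier [simp]: "z \<in> ej_disc n \<Longrightarrow> z \<in> carrier \<int>[\<rho>]"
  by (auto simp: ej_disc_def)

lemma EJ_carrier_rho_powi [simp]: "\<rho> powi j \<in> carrier \<int>[\<rho>]"
proof -
  \<comment> \<open>The quadratic equation makes \<rho> invertible inside the ring, which takes care
    of negative exponents.\<close>
  have "\<rho> * (1 - \<rho>) = 1"
    using ej_rho_power2 by (simp add: algebra_simps power2_eq_square)
  then have "inverse \<rho> = 1 - \<rho>"
    by (rule inverse_unique)
  then show ?thesis
    by (simp add: power_int_def)
qed

text \<open>Identifies the norm form with the squared absolute value, so that multiplicativity of
  the norm is inherited from the complex numbers.\<close>

lemma cmod_EJ: "(cmod (of_int x + of_int y * \<rho>))\<^sup>2 = of_int (x\<^sup>2 + x * y + y\<^sup>2)"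
  unfolding cmod_power2 by (simp add: ej_rho_eq power2_eq_square algebra_simps)

lemma cmod_rho [simp]: "cmod \<rho> = 1"
  using cmod_EJ[of 0 1] norm_ge_zero[of \<rho>] by (auto simp: power2_eq_1_iff simp del: norm_ge_zero)

lemma of_int_ej_norm: "z \<in> carrier \<int>[\<rho>] \<Longrightarrow> of_int (ej_norm z) = (cmod z)\<^sup>2"
  by (auto simp: EJ_carrier_iff ej_norm_eq cmod_EJ)

section \<open>Geometry of the hexagonal discs\<close>

lemma ej_disc_iff:
  "of_int x + of_int y * \<rho> \<in> ej_disc n \<longleftrightarrow>
    \<bar>x\<bar> \<le> int n \<and> \<bar>y\<bar> \<le> int n \<and> \<bar>x + y\<bar> \<le> int n"
  by (auto simp: ej_disc_def EJ_coords_unique)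

lemma ej_disc_0 [simp]: "ej_disc 0 = {0}"
  by (auto simp: ej_disc_def)

text \<open>Triangle inequality for the hexagonal length, in the form for differences because
  congruence is membership of a difference in an ideal.\<close>

lemma ej_disc_diff: "z \<in> ej_disc m \<Longrightarrow> w \<in> ej_disc n \<Longrightarrow> z - w \<in> ej_disc (m + n)"
proof -
  assume "z \<in> ej_disc m" "w \<in> ej_disc n"
  then obtain x y x' y' where
    z: "z = of_int x + of_int y * \<rho>" "\<bar>x\<bar> \<le> int m" "\<bar>y\<bar> \<le> int m" "\<bar>x + y\<bar> \<le> int m" and
    w: "w = of_int x' + of_int y' * \<rho>" "\<bar>x'\<bar> \<le> int n" "\<bar>y'\<bar> \<le> int n" "\<bar>x' + y'\<bar> \<le> int n"
    by (auto simp: ej_disc_def)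
  have "z - w = of_int (x - x') + of_int (y - y') * \<rho>"
    by (simp add: z w algebra_simps)
  also have "\<dots> \<in> ej_disc (m + n)"
    unfolding ej_disc_iff using z(2-4) w(2-4) by (auto simp: abs_le_iff)
  finally show ?thesis .
qed

lemma ej_disc_uminus: "z \<in> ej_disc n \<Longrightarrow> - z \<in> ej_disc n"
  using ej_disc_diff[of 0 0 z n] by simp

lemma ej_disc_mono: "m \<le> n \<Longrightarrow> ej_disc m \<subseteq> ej_disc n"
  by (fastforce simp: ej_disc_def)

lemma ej_units_disc: "u \<in> ej_units \<Longrightarrow> u \<in> ej_disc 1"
proof -
  have "1 \<in> ej_disc 1" "\<rho> \<in> ej_disc 1" "\<rho>\<^sup>2 \<in> ej_disc 1"
    using ej_disc_iff[of 1 0 1] ej_disc_iff[of 0 1 1] ej_disc_iff[of "- 1" 1 1]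
    by (simp_all add: ej_rho_power2)
  then show "u \<in> ej_units \<Longrightarrow> u \<in> ej_disc 1"
    by (auto simp: ej_units_def intro: ej_disc_uminus)
qed

lemma ej_units_iff: "of_int x + of_int y * \<rho> \<in> ej_units \<longleftrightarrow>
   (x, y) \<in> {(1, 0), (- 1, 0), (0, 1), (0, - 1), (- 1, 1), (1, - 1)}"
  unfolding ej_units_def ej_rho_power2
  using EJ_coords_unique[of x y 1 0] EJ_coords_unique[of x y "- 1" 0] EJ_coords_unique[of x y 0 1]
    EJ_coords_unique[of x y 0 "- 1"] EJ_coords_unique[of x y "- 1" 1] EJ_coords_unique[of x y 1 "- 1"]
  by simp

text \<open>Every point of length \<open>n + 1\<close> has a neighbour of length \<open>n\<close>.
  Together with the triangle inequality this makes the hexagonal length the word length with respect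
  to the six units.\<close>

lemma ej_disc_Suc_cases:
  assumes "z \<in> ej_disc (Suc n)"
  shows "z \<in> ej_disc n \<or> (\<exists>u\<in>ej_units. z - u \<in> ej_disc n)"
proof -
  obtain x y where z: "z = of_int x + of_int y * \<rho>"
    "\<bar>x\<bar> \<le> int n + 1" "\<bar>y\<bar> \<le> int n + 1" "\<bar>x + y\<bar> \<le> int n + 1"
    using assms by (auto simp: ej_disc_def)
  have step: ?thesis if "(p, q) \<in> {(1, 0), (- 1, 0), (0, 1), (0, - 1), (- 1, 1), (1, - 1)}"
     "\<bar>x - p\<bar> \<le> int n" "\<bar>y - q\<bar> \<le> int n" "\<bar>x - p + (y - q)\<bar> \<le> int n" for p q
  proof (intro disjI2 bexI)
    show "of_int p + of_int q * \<rho> \<in> ej_units"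
      using that(1) by (simp only: ej_units_iff)
    have "z - (of_int p + of_int q * \<rho>) = of_int (x - p) + of_int (y - q) * \<rho>"
      by (simp add: z algebra_simps)
    then show "z - (of_int p + of_int q * \<rho>) \<in> ej_disc n"
      using that(2-4) by (simp only: ej_disc_iff)
  qed
  \<comment> \<open>For coordinates of equal sign the length is \<open>\<bar>x + y\<bar>\<close>:
    either the point is already in the smaller disc, or a nonzero coordinate is reduced,
    \<open>x\<close> if possible. For opposite signs the step along \<open>1 - \<rho>\<close> or its
    negative shortens both coordinates at once.\<close>
  consider "x \<ge> 0" "y \<ge> 0" "x + y \<le> int n" | "x > 0" "y \<ge> 0" "x + y = int n + 1"
    | "x = 0" "y = int n + 1" | "x \<le> 0" "y \<le> 0" "x + y \<ge> - int n"
    | "x < 0" "y \<le> 0" "x + y = - int n - 1" | "x = 0" "y = - int n - 1"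
    | "x > 0" "y < 0" | "x < 0" "y > 0"
    using z(2-4) by (smt (verit))
  then show ?thesis
  proof cases
    case 1 then show ?thesis using ej_disc_iff z(1) by auto
  next
    case 2 then show ?thesis by (intro step[of 1 0]) auto
  next
    case 3 then show ?thesis by (intro step[of 0 1]) auto
  next
    case 4 then show ?thesis using ej_disc_iff z(1) by auto
  next
    case 5 then show ?thesis by (intro step[of "- 1" 0]) auto
  next
    case 6 then show ?thesis by (intro step[of 0 "- 1"]) auto
  next
    case 7 then show ?thesis using z by (intro step[of 1 "- 1"]) auto
  next
    case 8 then show ?thesis using z by (intro step[of "- 1" 1]) auto
  qed
qed

text \<open>Converse of \<open>ej_disc_diff\<close>, by removing one unit step at a time. It turns a
  short multiple of \<beta> into two congruent elements of a disc.\<close>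

lemma ej_disc_split:
  "z \<in> ej_disc (m + n) \<Longrightarrow> \<exists>v\<in>ej_disc m. \<exists>w\<in>ej_disc n. z = v - w"
proof (induction n arbitrary: z)
  case (Suc n)
  then have "z \<in> ej_disc (Suc (m + n))" by simp
  then consider "z \<in> ej_disc (m + n)" | u where "u \<in> ej_units" "z - u \<in> ej_disc (m + n)"
    using ej_disc_Suc_cases by blast
  then show ?case
  proof cases
    case 1
    then show ?thesis
      using Suc.IH ej_disc_mono[of n "Suc n"] by fastforce
  next
    case 2
    then obtain v w where vw: "v \<in> ej_disc m" "w \<in> ej_disc n" "z - u = v - w"
      using Suc.IH by blast
    then have "w - u \<in> ej_disc (Suc n)"
      using ej_disc_diff[OF vw(2) ej_units_disc[OF 2(1)]] by simp
    moreover have "z = v - (w - u)"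
      using vw(3) by (simp add: algebra_simps)
    ultimately show ?thesis
      using vw(1) by blast
  qed
qed (auto intro: bexI[of _ 0])

lemma card_ej_disc: "finite (ej_disc n)" "card (ej_disc n) = 3 * n\<^sup>2 + 3 * n + 1"
proof -
  \<comment> \<open>The bounds on \<open>y\<close> solve both \<open>\<bar>y\<bar> \<le> n\<close>
    and \<open>\<bar>x + y\<bar> \<le> n\<close>; the column over \<open>x\<close> thus has
    \<open>2 * n + 1 - \<bar>x\<bar>\<close> points.\<close>
  define S where "S = (SIGMA x:{- int n..int n}. {max (- int n) (- int n - x)..min (int n) (int n - x)})"
  let ?f = "\<lambda>(x, y). of_int x + of_int y * \<rho>"
  have S: "(x, y) \<in> S \<longleftrightarrow> \<bar>x\<bar> \<le> int n \<and> \<bar>y\<bar> \<le> int n \<and> \<bar>x + y\<bar> \<le> int n" for x y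
    by (auto simp: S_def)
  have disc: "ej_disc n = ?f ` S"
    unfolding ej_disc_def using S by (fastforce simp: image_def)
  have inj: "inj_on ?f S"
    by (auto simp: inj_on_def EJ_coords_unique)
  have sum_abs: "(\<Sum>x\<in>{- int k..int k}. \<bar>x\<bar>) = int (k * (k + 1))" for k
  proof (induction k)
    case (Suc k)
    have "{- int (Suc k)..int (Suc k)} = {- int k - 1, int k + 1} \<union> {- int k..int k}"
      by auto
    then show ?case
      using Suc by (simp add: algebra_simps sum.union_disjoint)
  qed simp
  have "int (card S) = (\<Sum>x\<in>{- int n..int n}. 2 * int n + 1 - \<bar>x\<bar>)"
    unfolding S_def by (subst card_SigmaI) (auto intro!: sum.cong)
  also have "\<dots> = (2 * int n + 1) * (2 * int n + 1) - int (n * (n + 1))"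
    by (simp add: sum_subtractf sum_abs)
  also have "\<dots> = int (3 * n\<^sup>2 + 3 * n + 1)"
    by (simp add: algebra_simps power2_eq_square)
  finally have "card S = 3 * n\<^sup>2 + 3 * n + 1"
    by (rule of_nat_eq_iff[THEN iffD1])
  then show "card (ej_disc n) = 3 * n\<^sup>2 + 3 * n + 1"
    by (simp add: disc card_image inj)
  show "finite (ej_disc n)"
    by (simp add: disc S_def)
qed

section \<open>Norm versus hexagonal length\<close>

lemma ej_disc_cmod: "z \<in> ej_disc n \<Longrightarrow> (cmod z)\<^sup>2 \<le> (of_nat n)\<^sup>2"
proof -
  assume "z \<in> ej_disc n"
  then obtain x y where z: "z = of_int x + of_int y * \<rho>"
    "\<bar>x\<bar> \<le> int n" "\<bar>y\<bar> \<le> int n" "\<bar>x + y\<bar> \<le> int n"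
    by (auto simp: ej_disc_def)
  have sq: "x\<^sup>2 \<le> (int n)\<^sup>2" "y\<^sup>2 \<le> (int n)\<^sup>2" "(x + y)\<^sup>2 \<le> (int n)\<^sup>2"
    using z(2-4) by (simp_all add: abs_le_square_iff[of _ "int n", symmetric])
  \<comment> \<open>Of the three numbers \<open>x\<close>, \<open>y\<close> and
    \<open>- (x + y)\<close>, two agree weakly in sign. The norm is the square of the third minus
    the product of these two, hence at most that square.\<close>
  have "x * y \<ge> 0 \<or> y * (x + y) \<le> 0 \<or> x * (x + y) \<le> 0"
    by (smt (verit) mult_nonneg_nonneg mult_nonpos_nonpos mult_nonneg_nonpos mult_nonpos_nonneg)
  then have "x\<^sup>2 + x * y + y\<^sup>2 \<le> (int n)\<^sup>2"
    using sq by (auto simp: power2_eq_square algebra_simps)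
  then have "real_of_int (x\<^sup>2 + x * y + y\<^sup>2) \<le> of_int ((int n)\<^sup>2)"
    by (simp only: of_int_le_iff)
  then show ?thesis
    by (simp add: z cmod_EJ)
qed

text \<open>Completing the square in either variable bounds both coordinates by 1 in absolute value;
  the rest is a finite check.\<close>

lemma ej_units_if_norm_eq_1:
  fixes x y :: int
  assumes "x\<^sup>2 + x * y + y\<^sup>2 = 1"
  shows "of_int x + of_int y * \<rho> \<in> ej_units"
proof -
  have "3 * x\<^sup>2 + (x + 2 * y)\<^sup>2 = 4" "3 * y\<^sup>2 + (2 * x + y)\<^sup>2 = 4"
    using assms by (simp_all add: power2_eq_square algebra_simps)
  then have "3 * x\<^sup>2 \<le> 4" "3 * y\<^sup>2 \<le> 4"
    using zero_le_power2[of "x + 2 * y"] zero_le_power2[of "2 * x + y"] by linarith+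
  then have "x\<^sup>2 < 2\<^sup>2" "y\<^sup>2 < 2\<^sup>2"
    by simp_all
  then have "\<bar>x\<bar> < 2" "\<bar>y\<bar> < 2"
    using power2_less_imp_less[of "\<bar>x\<bar>" 2] power2_less_imp_less[of "\<bar>y\<bar>" 2] by simp_all
  then have "x \<in> {- 1, 0, 1}" "y \<in> {- 1, 0, 1}"
    by auto
  then show ?thesis
    using assms unfolding ej_units_iff by auto
qed

text \<open>Nonunit multipliers are excluded by \<open>3/4 l\<^sup>2 \<le> N \<le> l\<^sup>2\<close> for the length \<open>l\<close>.\<close>
lemma mult_notin_ej_disc:
  fixes c d :: int
  assumes "\<gamma> \<in> carrier \<int>[\<rho>]" "\<gamma> \<noteq> 0" "c \<ge> 0" "d \<ge> 0" "int n < c + d"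
  shows "\<gamma> * (of_int c + of_int d * \<rho>) \<notin> ej_disc n"
proof
  assume *: "\<gamma> * (of_int c + of_int d * \<rho>) \<in> ej_disc n"
  obtain x y where \<gamma>: "\<gamma> = of_int x + of_int y * \<rho>"
    using assms(1) by (auto simp: EJ_carrier_iff)
  define N where "N = x\<^sup>2 + x * y + y\<^sup>2"
  have cmod_\<gamma>: "(cmod \<gamma>)\<^sup>2 = of_int N"
    by (simp add: \<gamma> cmod_EJ N_def)
  with \<open>\<gamma> \<noteq> 0\<close> have "N > 0"
    by (metis of_int_0_less_iff zero_less_norm_iff zero_less_power)
  consider "N = 1" | "N \<ge> 2"
    using \<open>N > 0\<close> by linarith
  then show False
  proof cases
    case 1
    then have "(x, y) \<in> {(1, 0), (- 1, 0), (0, 1), (0, - 1), (- 1, 1), (1, - 1)}"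
      using ej_units_if_norm_eq_1[of x y] unfolding N_def ej_units_iff by simp
    then show False
      \<comment> \<open>A unit multiple has coordinates \<open>(c, d)\<close>,
        \<open>(- d, c + d)\<close> or \<open>(- c - d, c)\<close> up to sign, so one of the three
        quantities bounding the disc equals \<open>c + d\<close> in absolute value.\<close>
      using * assms(3-5) unfolding \<gamma> EJ_mult_coords ej_disc_iff by auto
  next
    case 2
    have "(int n)\<^sup>2 < (c + d)\<^sup>2"
      using assms(5) by (intro power_strict_mono) auto
    \<comment> \<open>The difference of the two sides is \<open>c\<^sup>2 + d\<^sup>2\<close>, so a
      factor of norm at least 2 already makes up for the gap between norm and squared
      length.\<close>
    also have "\<dots> \<le> 2 * (c\<^sup>2 + c * d + d\<^sup>2)"
      using assms(3,4) by (simp add: power2_eq_square algebra_simps)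
    also have "\<dots> \<le> N * (c\<^sup>2 + c * d + d\<^sup>2)"
      using 2 assms(3,4) by (intro mult_right_mono) auto
    finally have "real_of_int ((int n)\<^sup>2) < of_int (N * (c\<^sup>2 + c * d + d\<^sup>2))"
      by (simp only: of_int_less_iff)
    also have "\<dots> = (cmod (\<gamma> * (of_int c + of_int d * \<rho>)))\<^sup>2"
      by (simp only: norm_mult power_mult_distrib cmod_\<gamma> cmod_EJ of_int_mult)
    also have "\<dots> \<le> (of_nat n)\<^sup>2"
      using * by (rule ej_disc_cmod)
    finally show False by simp
  qed
qed

section \<open>Principal ideals and residue systems\<close>

lemma mem_EJ_PIdl_iff: "z \<in> PIdl\<^bsub>\<int>[\<rho>]\<^esub> \<beta> \<longleftrightarrow> (\<exists>w\<in>carrier \<int>[\<rho>]. z = w * \<beta>)"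
  by (auto simp: cgenideal_def)

lemma EJ_PIdl_add:
  "z \<in> PIdl\<^bsub>\<int>[\<rho>]\<^esub> \<beta> \<Longrightarrow> w \<in> PIdl\<^bsub>\<int>[\<rho>]\<^esub> \<beta> \<Longrightarrow> z + w \<in> PIdl\<^bsub>\<int>[\<rho>]\<^esub> \<beta>"
  unfolding mem_EJ_PIdl_iff by (metis EJ_carrier_add distrib_right)

lemma EJ_PIdl_mult:
  "r \<in> carrier \<int>[\<rho>] \<Longrightarrow> z \<in> PIdl\<^bsub>\<int>[\<rho>]\<^esub> \<beta> \<Longrightarrow> r * z \<in> PIdl\<^bsub>\<int>[\<rho>]\<^esub> \<beta>"
  unfolding mem_EJ_PIdl_iff by (metis EJ_carrier_mult mult.assoc)

lemma EJ_PIdl_uminus: "z \<in> PIdl\<^bsub>\<int>[\<rho>]\<^esub> \<beta> \<Longrightarrow> - z \<in> PIdl\<^bsub>\<int>[\<rho>]\<^esub> \<beta>"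
  using EJ_PIdl_mult[of "- 1" z \<beta>] by simp

lemma EJ_PIdl_diff:
  "z \<in> PIdl\<^bsub>\<int>[\<rho>]\<^esub> \<beta> \<Longrightarrow> w \<in> PIdl\<^bsub>\<int>[\<rho>]\<^esub> \<beta> \<Longrightarrow> z - w \<in> PIdl\<^bsub>\<int>[\<rho>]\<^esub> \<beta>"
  using EJ_PIdl_add[OF _ EJ_PIdl_uminus, of z \<beta> w] by simp

lemma EJ_PIdl_diff_commute:
  "z - w \<in> PIdl\<^bsub>\<int>[\<rho>]\<^esub> \<beta> \<longleftrightarrow> w - z \<in> PIdl\<^bsub>\<int>[\<rho>]\<^esub> \<beta>"
  using EJ_PIdl_uminus[of "z - w" \<beta>] EJ_PIdl_uminus[of "w - z" \<beta>] by auto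

lemma EJ_PIdl_diff_trans:
  "x - y \<in> PIdl\<^bsub>\<int>[\<rho>]\<^esub> \<beta> \<Longrightarrow> y - z \<in> PIdl\<^bsub>\<int>[\<rho>]\<^esub> \<beta> \<Longrightarrow> x - z \<in> PIdl\<^bsub>\<int>[\<rho>]\<^esub> \<beta>"
  using EJ_PIdl_add[of "x - y" \<beta> "y - z"] by simp

lemma EJ_PIdl_0 [simp]: "0 \<in> PIdl\<^bsub>\<int>[\<rho>]\<^esub> \<beta>"
  unfolding mem_EJ_PIdl_iff by (intro bexI[of _ 0]) simp_all

lemma EJ_PIdl_self: "\<beta> \<in> PIdl\<^bsub>\<int>[\<rho>]\<^esub> \<beta>"
  unfolding mem_EJ_PIdl_iff by (intro bexI[of _ 1]) simp_all

lemma EJ_PIdl_carrier: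
  "\<beta> \<in> carrier \<int>[\<rho>] \<Longrightarrow> z \<in> PIdl\<^bsub>\<int>[\<rho>]\<^esub> \<beta> \<Longrightarrow> z \<in> carrier \<int>[\<rho>]"
  by (auto simp: mem_EJ_PIdl_iff)

lemma EJ_PIdl_subset:
  assumes "\<beta> \<in> PIdl\<^bsub>\<int>[\<rho>]\<^esub> \<beta>'"
  shows "PIdl\<^bsub>\<int>[\<rho>]\<^esub> \<beta> \<subseteq> PIdl\<^bsub>\<int>[\<rho>]\<^esub> \<beta>'"
proof
  fix z assume "z \<in> PIdl\<^bsub>\<int>[\<rho>]\<^esub> \<beta>"
  then obtain w where "w \<in> carrier \<int>[\<rho>]" "z = w * \<beta>"
    by (auto simp: mem_EJ_PIdl_iff)
  with EJ_PIdl_mult[OF _ assms] show "z \<in> PIdl\<^bsub>\<int>[\<rho>]\<^esub> \<beta>'" by simp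
qed

lemma int_dvd_abs_less_imp_0: "(m::int) dvd k \<Longrightarrow> \<bar>k\<bar> < m \<Longrightarrow> k = 0"
  using zdvd_not_zless[of "\<bar>k\<bar>" m] by (cases "k = 0") auto

text \<open>The representatives come from the Hermite normal form of the lattice \<open>(\<beta>)\<close>:
  with \<open>g = gcd c d\<close> it is spanned by \<open>N(\<beta>) / g\<close> and an element \<open>m + g\<rho>\<close>.\<close>
lemma EJ_transversal:
  assumes "\<beta> \<in> carrier \<int>[\<rho>]" "\<beta> \<noteq> 0"
  obtains R where "R \<subseteq> carrier \<int>[\<rho>]" "finite R" "int (card R) = ej_norm \<beta>"
    "\<forall>z\<in>carrier \<int>[\<rho>]. \<exists>!w. w \<in> R \<and> z - w \<in> PIdl\<^bsub>\<int>[\<rho>]\<^esub> \<beta>"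
proof -
  obtain c d where \<beta>: "\<beta> = of_int c + of_int d * \<rho>"
    using assms(1) by (auto simp: EJ_carrier_iff)
  with assms(2) have "c \<noteq> 0 \<or> d \<noteq> 0" by auto
  define N where "N = c\<^sup>2 + c * d + d\<^sup>2"
  define g where "g = gcd c d"
  define M where "M = N div g"
  have "g > 0"
    unfolding g_def using \<open>c \<noteq> 0 \<or> d \<noteq> 0\<close> by simp
  have norm: "ej_norm \<beta> = N"
    by (simp add: \<beta> N_def ej_norm_eq)
  have "real_of_int N > 0"
    using of_int_ej_norm[OF assms(1)] assms(2) by (simp add: norm)
  then have "N > 0" by simp
  have g_dvd: "g dvd c" "g dvd d"
    by (simp_all add: g_def)
  then have "g dvd N"
    by (simp add: N_def power2_eq_square)
  then have N: "N = M * g"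
    by (simp add: M_def)
  with \<open>N > 0\<close> \<open>g > 0\<close> have "M > 0"
    by (simp add: zero_less_mult_iff)
  let ?f = "\<lambda>(i, j). of_int i + of_int j * \<rho>"
  define R where "R = ?f ` ({0..<M} \<times> {0..<g})"
  have inj: "inj_on ?f ({0..<M} \<times> {0..<g})"
    by (auto simp: inj_on_def EJ_coords_unique)
  have unique: "w = w'"
    if R: "w \<in> R" "w' \<in> R" and I: "w - w' \<in> PIdl\<^bsub>\<int>[\<rho>]\<^esub> \<beta>" for w w'
  proof -
    obtain i j i' j' where w: "w = of_int i + of_int j * \<rho>" "0 \<le> i" "i < M" "0 \<le> j" "j < g"
      and w': "w' = of_int i' + of_int j' * \<rho>" "0 \<le> i'" "i' < M" "0 \<le> j'" "j' < g"
      using R by (auto simp: R_def)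
    obtain v where v: "v \<in> carrier \<int>[\<rho>]" "w - w' = v * \<beta>"
      using I unfolding mem_EJ_PIdl_iff by blast
    then obtain x y where "v = of_int x + of_int y * \<rho>"
      unfolding EJ_carrier_iff by blast
    with v(2) have "w - w' = (of_int x + of_int y * \<rho>) * \<beta>"
      by simp
    moreover have "w - w' = of_int (i - i') + of_int (j - j') * \<rho>"
      by (simp add: w w' algebra_simps)
    ultimately have "of_int (i - i') + of_int (j - j') * \<rho> =
      (of_int x + of_int y * \<rho>) * (of_int c + of_int d * \<rho>)"
      by (simp only: \<beta>)
    then have eqs: "i - i' = x * c - y * d" "j - j' = x * d + y * c + y * d"
      unfolding EJ_mult_coords EJ_coords_unique by auto
    have "g dvd j - j'"
      unfolding eqs using g_dvd by simp
    moreover have "\<bar>j - j'\<bar> < g"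
      using w w' by linarith
    ultimately have "j = j'"
      using int_dvd_abs_less_imp_0 by fastforce
    then have 0: "x * d + y * c + y * d = 0"
      using eqs(2) by simp
    define k where "k = i - i'"
    \<comment> \<open>Now \<open>k = v * \<beta>\<close>, and multiplying by the conjugate of
      \<beta> gives \<open>x * N = k * (c + d)\<close> and \<open>y * N = - k * d\<close>. The two
      identities express this with the vanishing \<rho>-coordinate as a correction term.\<close>
    have "k * d = c * (x * d + y * c + y * d) - y * N"
      by (simp add: k_def eqs N_def algebra_simps power2_eq_square)
    moreover have "k * c = (x + y) * N - (c + d) * (x * d + y * c + y * d)"
      by (simp add: k_def eqs N_def algebra_simps power2_eq_square)
    ultimately have "N dvd k * c" "N dvd k * d"
      by (simp_all add: 0)
    then have "N dvd gcd (k * c) (k * d)"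
      by (rule gcd_greatest)
    also have "gcd (k * c) (k * d) = \<bar>k\<bar> * g"
      by (simp add: g_def gcd_mult_distrib_int)
    finally have "M * g dvd \<bar>k\<bar> * g"
      by (simp only: N)
    then have "M dvd k"
      using \<open>g > 0\<close> by simp
    moreover have "\<bar>k\<bar> < M"
      using w w' unfolding k_def by linarith
    ultimately have "i = i'"
      using int_dvd_abs_less_imp_0[of M k] by (simp add: k_def)
    then show "w = w'"
      using \<open>j = j'\<close> by (simp add: w w')
  qed
  have cover: "\<exists>w\<in>R. z - w \<in> PIdl\<^bsub>\<int>[\<rho>]\<^esub> \<beta>" if E: "z \<in> carrier \<int>[\<rho>]" for z
  proof -
    obtain x y where z: "z = of_int x + of_int y * \<rho>"
      using E by (auto simp: EJ_carrier_iff)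
    obtain u v where uv: "u * c + v * d = g"
      unfolding g_def using bezout_int by blast
    \<comment> \<open>\<open>m\<close> is the first coordinate of the multiple of \<beta> by
      \<open>(v - u) + u\<rho>\<close>, a multiplier chosen so that the \<rho>-coordinate becomes
      the Bezout sum \<open>u * c + v * d\<close>.\<close>
    define m where "m = (v - u) * c - u * d"
    have "of_int m + of_int g * \<rho> = (of_int (v - u) + of_int u * \<rho>) * \<beta>"
      unfolding \<beta> EJ_mult_coords EJ_coords_unique m_def using uv by (simp add: algebra_simps)
    then have e: "of_int m + of_int g * \<rho> \<in> PIdl\<^bsub>\<int>[\<rho>]\<^esub> \<beta>"
      unfolding mem_EJ_PIdl_iff using EJ_in_carrier by blast
    obtain c' d' where c'd': "c = g * c'" "d = g * d'"
      using g_dvd unfolding dvd_def by blast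
    have "N = (g * c' * c' + g * c' * d' + g * d' * d') * g"
      by (simp add: N_def c'd' power2_eq_square algebra_simps)
    then have M: "M = g * c' * c' + g * c' * d' + g * d' * d'"
      unfolding M_def using \<open>g > 0\<close> by simp
    \<comment> \<open>The multiplier is the conjugate \<open>(c + d) - d\<rho>\<close> of \<beta>
      divided by \<open>g\<close>, and \<beta> times its conjugate is \<open>N\<close>.\<close>
    have "of_int M + of_int 0 * \<rho> = (of_int (c' + d') + of_int (- d') * \<rho>) * \<beta>"
      unfolding \<beta> EJ_mult_coords EJ_coords_unique M c'd' by (simp add: algebra_simps)
    then have "of_int M + of_int 0 * \<rho> \<in> PIdl\<^bsub>\<int>[\<rho>]\<^esub> \<beta>"
      unfolding mem_EJ_PIdl_iff using EJ_in_carrier by blast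
    then have M_mem: "of_int M \<in> PIdl\<^bsub>\<int>[\<rho>]\<^esub> \<beta>" by simp
    \<comment> \<open>Subtracting \<open>q\<close> copies of \<open>m + g\<rho>\<close> brings the
      \<rho>-coordinate into \<open>{0..<g}\<close> and changes the other one to \<open>x'\<close>,
      which is then reduced modulo \<open>M\<close>.\<close>
    define q where "q = y div g"
    define x' where "x' = x - q * m"
    define w where "w = of_int (x' mod M) + of_int (y mod g) * \<rho>"
    have "w \<in> R"
      unfolding R_def w_def using \<open>M > 0\<close> \<open>g > 0\<close>
      by (intro image_eqI[of _ _ "(x' mod M, y mod g)"]) auto
    moreover have "z - w = of_int q * (of_int m + of_int g * \<rho>) + of_int (x' div M) * of_int M"
    proof -
      have "complex_of_int x' = of_int (x' div M) * of_int M + of_int (x' mod M)"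
        "complex_of_int y = of_int q * of_int g + of_int (y mod g)"
        by (simp_all only: of_int_mult[symmetric] of_int_add[symmetric] q_def div_mult_mod_eq)
      moreover have "complex_of_int x = of_int q * of_int m + of_int x'"
        by (simp add: x'_def)
      ultimately show ?thesis
        unfolding z w_def by (simp only:) (simp add: algebra_simps)
    qed
    moreover have "\<dots> \<in> PIdl\<^bsub>\<int>[\<rho>]\<^esub> \<beta>"
      by (intro EJ_PIdl_add EJ_PIdl_mult e M_mem EJ_carrier_of_int)
    ultimately show ?thesis
      by (intro bexI[of _ w]) (simp_all only:)
  qed
  show ?thesis
  proof (rule that[of R])
    show "R \<subseteq> carrier \<int>[\<rho>]" "finite R"
      by (auto simp: R_def)
    show "int (card R) = ej_norm \<beta>"
      using \<open>M > 0\<close> \<open>g > 0\<close> by (simp add: R_def card_image inj norm N)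
    show "\<forall>z\<in>carrier \<int>[\<rho>]. \<exists>!w. w \<in> R \<and> z - w \<in> PIdl\<^bsub>\<int>[\<rho>]\<^esub> \<beta>"
    proof (intro ballI ex_ex1I)
      fix z assume z: "z \<in> carrier \<int>[\<rho>]"
      show "\<exists>w. w \<in> R \<and> z - w \<in> PIdl\<^bsub>\<int>[\<rho>]\<^esub> \<beta>"
        using cover[OF z] by blast
    next
      fix z w w' assume w: "w \<in> R \<and> z - w \<in> PIdl\<^bsub>\<int>[\<rho>]\<^esub> \<beta>" "w' \<in> R \<and> z - w' \<in> PIdl\<^bsub>\<int>[\<rho>]\<^esub> \<beta>"
      then have "(z - w') - (z - w) \<in> PIdl\<^bsub>\<int>[\<rho>]\<^esub> \<beta>"
        using EJ_PIdl_diff by blast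
      then show "w = w'"
        using w by (intro unique) simp_all
    qed
  qed
qed

text \<open>Pigeonhole principle: by \<open>sep\<close> the map \<open>f\<close> to the
  representatives in \<open>R\<close> is injective on the disc. The disc meets every class iff
  \<open>f\<close> maps it onto \<open>R\<close>, that is, iff the two finite cardinalities
  agree.\<close>

lemma ej_disc_cover_iff_norm:
  assumes "\<beta> \<in> carrier \<int>[\<rho>]" "\<beta> \<noteq> 0"
    and sep: "\<And>z w. z \<in> ej_disc t \<Longrightarrow> w \<in> ej_disc t \<Longrightarrow> z - w \<in> PIdl\<^bsub>\<int>[\<rho>]\<^esub> \<beta> \<Longrightarrow> z = w"
  shows "(\<forall>z\<in>carrier \<int>[\<rho>]. \<exists>w\<in>ej_disc t. z - w \<in> PIdl\<^bsub>\<int>[\<rho>]\<^esub> \<beta>) \<longleftrightarrow>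
    ej_norm \<beta> = int (3 * t\<^sup>2 + 3 * t + 1)"
proof -
  obtain R where R: "R \<subseteq> carrier \<int>[\<rho>]" "finite R" "int (card R) = ej_norm \<beta>"
    and ex1: "\<forall>z\<in>carrier \<int>[\<rho>]. \<exists>!w. w \<in> R \<and> z - w \<in> PIdl\<^bsub>\<int>[\<rho>]\<^esub> \<beta>"
    by (rule EJ_transversal[OF assms(1,2)])
  define f where "f z = (THE w. w \<in> R \<and> z - w \<in> PIdl\<^bsub>\<int>[\<rho>]\<^esub> \<beta>)" for z
  have f_conj: "f z \<in> R \<and> z - f z \<in> PIdl\<^bsub>\<int>[\<rho>]\<^esub> \<beta>" if "z \<in> carrier \<int>[\<rho>]" for z
    unfolding f_def by (rule theI'[OF bspec[OF ex1 that]])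
  note f = conjunct1[OF f_conj] conjunct2[OF f_conj]
  have f_eq: "f z = w" if "z \<in> carrier \<int>[\<rho>]" "w \<in> R" "z - w \<in> PIdl\<^bsub>\<int>[\<rho>]\<^esub> \<beta>" for z w
    unfolding f_def using bspec[OF ex1 that(1)] conjI[OF that(2,3)] by (rule the1_equality)
  have f_diff: "z - w \<in> PIdl\<^bsub>\<int>[\<rho>]\<^esub> \<beta>"
    if "z \<in> carrier \<int>[\<rho>]" "w \<in> carrier \<int>[\<rho>]" "f z = f w" for z w
    using EJ_PIdl_diff[OF f(2)[OF that(1)] f(2)[OF that(2)]] that(3) by simp
  have "inj_on f (ej_disc t)"
  proof (rule inj_onI)
    fix z w assume zw: "z \<in> ej_disc t" "w \<in> ej_disc t" "f z = f w"
    then show "z = w"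
      using sep[OF zw(1,2)] f_diff[of z w] by simp
  qed
  then have card: "card (f ` ej_disc t) = 3 * t\<^sup>2 + 3 * t + 1"
    by (simp add: card_image card_ej_disc)
  have sub: "f ` ej_disc t \<subseteq> R"
    by (rule image_subsetI) (rule f(1)[OF ej_disc_carrier])
  show ?thesis
  proof
    assume cover: "\<forall>z\<in>carrier \<int>[\<rho>]. \<exists>w\<in>ej_disc t. z - w \<in> PIdl\<^bsub>\<int>[\<rho>]\<^esub> \<beta>"
    have "R \<subseteq> f ` ej_disc t"
    proof
      fix z assume "z \<in> R"
      with R(1) have "z \<in> carrier \<int>[\<rho>]" by (rule subsetD)
      from bspec[OF cover this] obtain w
        where w: "z - w \<in> PIdl\<^bsub>\<int>[\<rho>]\<^esub> \<beta>" "w \<in> ej_disc t"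
        by (rule bexE)
      then have "w - z \<in> PIdl\<^bsub>\<int>[\<rho>]\<^esub> \<beta>"
        by (simp only: EJ_PIdl_diff_commute[of w z])
      then have "f w = z"
        by (rule f_eq[OF ej_disc_carrier[OF w(2)] \<open>z \<in> R\<close>])
      with w(2) show "z \<in> f ` ej_disc t" by blast
    qed
    with sub have "f ` ej_disc t = R" by blast
    then show "ej_norm \<beta> = int (3 * t\<^sup>2 + 3 * t + 1)"
      using R(3) by (simp only: card[symmetric])
  next
    assume "ej_norm \<beta> = int (3 * t\<^sup>2 + 3 * t + 1)"
    with R(3) have "int (card R) = int (3 * t\<^sup>2 + 3 * t + 1)" by (simp only:)
    then have "card (f ` ej_disc t) = card R"
      by (simp only: card of_nat_eq_iff)
    with R(2) sub have eq: "f ` ej_disc t = R"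
      by (rule card_subset_eq)
    show "\<forall>z\<in>carrier \<int>[\<rho>]. \<exists>w\<in>ej_disc t. z - w \<in> PIdl\<^bsub>\<int>[\<rho>]\<^esub> \<beta>"
    proof
      fix z assume z: "z \<in> carrier \<int>[\<rho>]"
      then have "f z \<in> f ` ej_disc t"
        unfolding eq by (rule f(1))
      then obtain w where w: "f z = f w" "w \<in> ej_disc t"
        by (rule imageE)
      with z show "\<exists>w\<in>ej_disc t. z - w \<in> PIdl\<^bsub>\<int>[\<rho>]\<^esub> \<beta>"
        by (intro bexI[of _ w] f_diff) simp_all
    qed
  qed
qed

section \<open>The graph on the quotient: walks, balls and perfect codes\<close>

context
  fixes \<alpha> :: complex
  assumes \<alpha>: "\<alpha> \<in> carrier \<int>[\<rho>]"
begin

lemma EJ_ideal: "ideal (PIdl\<^bsub>\<int>[\<rho>]\<^esub> \<alpha>) \<int>[\<rho>]"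
  by (rule cring.cgenideal_ideal[OF EJ_ring_cring \<alpha>])

lemma EJ_class_hom: "ring_hom_ring \<int>[\<rho>] (EJ_quot \<alpha>) (EJ_class \<alpha>)"
  using ideal.rcos_ring_hom_ring[OF EJ_ideal] unfolding EJ_quot_def EJ_class_def .

lemma EJ_class_eq_iff: 
  assumes "z \<in> carrier \<int>[\<rho>]" "w \<in> carrier \<int>[\<rho>]"
  shows "EJ_class \<alpha> z = EJ_class \<alpha> w \<longleftrightarrow> z - w \<in> PIdl\<^bsub>\<int>[\<rho>]\<^esub> \<alpha>"
proof -
  have mem: "v \<in> EJ_class \<alpha> z \<longleftrightarrow> v - z \<in> PIdl\<^bsub>\<int>[\<rho>]\<^esub> \<alpha>" for v z
    unfolding EJ_class_def a_r_coset_def'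
    by (auto intro: bexI[of _ "v - z"])
  show ?thesis
    unfolding set_eq_iff mem
    by (metis EJ_PIdl_0 EJ_PIdl_diff_commute EJ_PIdl_diff_trans diff_self)
qed

lemma EJ_quot_carrier: "carrier (EJ_quot \<alpha>) = EJ_class \<alpha> ` carrier \<int>[\<rho>]"
  by (auto simp: EJ_quot_def FactRing_def A_RCOSETS_def' EJ_class_def)

lemma EJ_class_diff:
  assumes "z \<in> carrier \<int>[\<rho>]" "w \<in> carrier \<int>[\<rho>]"
  shows "EJ_class \<alpha> z \<oplus>\<^bsub>EJ_quot \<alpha>\<^esub> \<ominus>\<^bsub>EJ_quot \<alpha>\<^esub> EJ_class \<alpha> w = EJ_class \<alpha> (z - w)"
proof -
  interpret h: ring_hom_ring "\<int>[\<rho>]" "EJ_quot \<alpha>" "EJ_class \<alpha>"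
    by (rule EJ_class_hom)
  show ?thesis
    using h.hom_add[of z "- w"] h.hom_a_inv[of w] assms by simp
qed

text \<open>Lifts the connection set to the ring, so that an arc of the quotient becomes a step by a
  unit.\<close>

lemma EJ_connection_set_eq: "EJ_connection_set \<alpha> = EJ_class \<alpha> ` ej_units"
proof -
  interpret h: ring_hom_ring "\<int>[\<rho>]" "EJ_quot \<alpha>" "EJ_class \<alpha>"
    by (rule EJ_class_hom)
  have "\<ominus>\<^bsub>EJ_quot \<alpha>\<^esub> EJ_class \<alpha> u = EJ_class \<alpha> (- u)" if "u \<in> carrier \<int>[\<rho>]" for u
    using h.hom_a_inv[of u] that by simp
  then show ?thesis
    by (auto simp: EJ_connection_set_def ej_units_def)
qed

lemma EJ_graph_verts: "verts (EJ_graph \<alpha>) = EJ_class \<alpha> ` carrier \<int>[\<rho>]"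
  by (simp add: EJ_graph_def cayley_graph_def EJ_quot_carrier)

lemma EJ_graph_arc_iff:
  assumes "z \<in> carrier \<int>[\<rho>]" "w \<in> carrier \<int>[\<rho>]"
  shows "(EJ_class \<alpha> z, EJ_class \<alpha> w) \<in> arcs (EJ_graph \<alpha>) \<longleftrightarrow>
    (\<exists>u\<in>ej_units. EJ_class \<alpha> (z - w) = EJ_class \<alpha> u)"
  unfolding EJ_graph_def cayley_graph_def a_inv_def[symmetric]
  using assms EJ_class_diff[OF assms] by (auto simp: EJ_quot_carrier EJ_connection_set_eq)

lemma EJ_graph_arc_ends [simp]: "tail (EJ_graph \<alpha>) = fst" "head (EJ_graph \<alpha>) = snd"
  by (simp_all add: EJ_graph_def cayley_graph_def)

text \<open>Walks lift to the ring: each arc changes the position by a unit, and the sums of at most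
  \<open>n\<close> units fill exactly \<open>ej_disc n\<close>. The induction varies
  \<open>z\<close> because the first arc moves the starting point.\<close>

lemma EJ_graph_awalk_iff:
  assumes "z \<in> carrier \<int>[\<rho>]"
  shows "(\<exists>p. pre_digraph.awalk (EJ_graph \<alpha>) (EJ_class \<alpha> z) p v \<and> length p \<le> n) \<longleftrightarrow>
    v \<in> (\<lambda>d. EJ_class \<alpha> (z + d)) ` ej_disc n"
proof -
  interpret wf_digraph "EJ_graph \<alpha>"
    unfolding EJ_graph_def by (rule wf_digraph_cayley_graph)
  show ?thesis
    using assms
  proof (induction n arbitrary: z)
    case 0
    then show ?case
      by (auto simp: awalk_Nil_iff EJ_graph_verts)
  next
    case (Suc n)
    show ?case
    proof
      assume "\<exists>p. awalk (EJ_class \<alpha> z) p v \<and> length p \<le> Suc n"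
      then obtain p where p: "awalk (EJ_class \<alpha> z) p v" "length p \<le> Suc n" by blast
      show "v \<in> (\<lambda>d. EJ_class \<alpha> (z + d)) ` ej_disc (Suc n)"
      proof (cases p)
        case Nil
        then show ?thesis
          using p ej_disc_mono[of 0 "Suc n"] by (auto simp: awalk_Nil_iff intro!: image_eqI[of _ _ 0])
      next
        case (Cons e es)
        then have e: "e \<in> arcs (EJ_graph \<alpha>)" "EJ_class \<alpha> z = fst e" and
          es: "awalk (snd e) es v" "length es \<le> n"
          using p by (auto simp: awalk_Cons_iff)
        obtain w where w: "w \<in> carrier \<int>[\<rho>]" "snd e = EJ_class \<alpha> w"
          using awalk_hd_in_verts[OF es(1)] by (auto simp: EJ_graph_verts)
        have "e = (EJ_class \<alpha> z, EJ_class \<alpha> w)"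
          using e(2) w(2) by (simp add: prod_eq_iff)
        then obtain u where u: "u \<in> ej_units" "EJ_class \<alpha> (z - w) = EJ_class \<alpha> u"
          using e(1) EJ_graph_arc_iff[OF Suc.prems w(1)] by auto
        obtain d where d: "d \<in> ej_disc n" "v = EJ_class \<alpha> (w + d)"
          using Suc.IH[OF w(1)] es w(2) by auto
        \<comment> \<open>The first arc leads to a point congruent to \<open>z - u\<close>, so a
          displacement \<open>d\<close> from there is the displacement \<open>d - u\<close> from
          \<open>z\<close>.\<close>
        have "z - w - u \<in> PIdl\<^bsub>\<int>[\<rho>]\<^esub> \<alpha>"
          using u w Suc.prems by (subst (asm) EJ_class_eq_iff) auto
        then have "EJ_class \<alpha> (z + (d - u)) = EJ_class \<alpha> (w + d)"
          using u(1) w(1) d(1) Suc.prems by (subst EJ_class_eq_iff) (auto simp: algebra_simps)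
        moreover have "d - u \<in> ej_disc (Suc n)"
          using ej_disc_diff[OF d(1) ej_units_disc[OF u(1)]] by simp
        ultimately show ?thesis
          using d(2) by blast
      qed
    next
      assume "v \<in> (\<lambda>d. EJ_class \<alpha> (z + d)) ` ej_disc (Suc n)"
      then obtain d where d: "d \<in> ej_disc (Suc n)" "v = EJ_class \<alpha> (z + d)" by blast
      from ej_disc_Suc_cases[OF d(1)]
      show "\<exists>p. awalk (EJ_class \<alpha> z) p v \<and> length p \<le> Suc n"
      proof (elim disjE bexE)
        assume "d \<in> ej_disc n"
        then show ?thesis
          using Suc.IH[OF Suc.prems] d(2) le_SucI by blast
      next
        fix u assume u: "u \<in> ej_units" "d - u \<in> ej_disc n"
        have "v \<in> (\<lambda>d'. EJ_class \<alpha> (z + u + d')) ` ej_disc n"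
          using d(2) u(2) by (intro image_eqI[of _ _ "d - u"]) simp_all
        then obtain p where p: "awalk (EJ_class \<alpha> (z + u)) p v" "length p \<le> n"
          using Suc.IH[of "z + u"] Suc.prems u by (metis EJ_carrier_add ej_units_carrier)
        \<comment> \<open>An arc requires tail minus head to be a unit class; going from
          \<open>z\<close> to \<open>z + u\<close> therefore uses \<open>- u\<close>.\<close>
        have "- u \<in> ej_units"
          using u(1) by (auto simp: ej_units_def)
        then have "(EJ_class \<alpha> z, EJ_class \<alpha> (z + u)) \<in> arcs (EJ_graph \<alpha>)"
          using Suc.prems u(1) by (subst EJ_graph_arc_iff) auto
        then have "awalk (EJ_class \<alpha> z) ((EJ_class \<alpha> z, EJ_class \<alpha> (z + u)) # p) v"
          using p(1) by (simp add: awalk_Cons_iff)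
        then show ?thesis
          using p(2) by (metis length_Cons Suc_le_mono)
      qed
    qed
  qed
qed

lemma graph_ball_EJ_graph:
  assumes "z \<in> carrier \<int>[\<rho>]"
  shows "graph_ball (EJ_graph \<alpha>) n (EJ_class \<alpha> z) = (\<lambda>d. EJ_class \<alpha> (z + d)) ` ej_disc n"
proof -
  have "graph_ball (EJ_graph \<alpha>) n (EJ_class \<alpha> z) =
    {v \<in> EJ_class \<alpha> ` carrier \<int>[\<rho>]. v \<in> (\<lambda>d. EJ_class \<alpha> (z + d)) ` ej_disc n}"
    unfolding EJ_graph_awalk_iff[OF assms, symmetric] EJ_quot_carrier[symmetric]
    by (simp add: EJ_graph_def graph_ball_cayley_graph)
  then show ?thesis
    using assms by auto
qed

text \<open>Disjointness of balls only yields equality of centres modulo \<alpha>;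
  \<open>small\<close> upgrades this to equality of disc elements in the ring. Covering transfers
  directly because \<open>(\<alpha>)\<close> lies in \<open>(\<beta>)\<close>.\<close>

lemma perfect_code_EJ_iff:
  assumes \<beta>: "\<beta> \<in> carrier \<int>[\<rho>]" "\<alpha> \<in> PIdl\<^bsub>\<int>[\<rho>]\<^esub> \<beta>"
    and small: "\<And>z. z \<in> ej_disc (t + t) \<Longrightarrow> z \<in> PIdl\<^bsub>\<int>[\<rho>]\<^esub> \<alpha> \<Longrightarrow> z = 0"
  shows "perfect_code (EJ_graph \<alpha>) t (EJ_ideal_quot \<beta> \<alpha>) \<longleftrightarrow>
    (\<forall>z\<in>ej_disc t. \<forall>w\<in>ej_disc t. z - w \<in> PIdl\<^bsub>\<int>[\<rho>]\<^esub> \<beta> \<longrightarrow> z = w) \<and>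
    (\<forall>z\<in>carrier \<int>[\<rho>]. \<exists>w\<in>ej_disc t. z - w \<in> PIdl\<^bsub>\<int>[\<rho>]\<^esub> \<beta>)"
    (is "_ \<longleftrightarrow> ?sep \<and> ?cover")
proof -
  let ?C = "EJ_ideal_quot \<beta> \<alpha>"
  let ?B = "graph_ball (EJ_graph \<alpha>) t"
  have sub: "PIdl\<^bsub>\<int>[\<rho>]\<^esub> \<alpha> \<subseteq> PIdl\<^bsub>\<int>[\<rho>]\<^esub> \<beta>"
    by (rule EJ_PIdl_subset[OF \<beta>(2)])
  have carr: "z \<in> carrier \<int>[\<rho>]" if "z \<in> PIdl\<^bsub>\<int>[\<rho>]\<^esub> \<beta>" for z
    using EJ_PIdl_carrier[OF \<beta>(1) that] .
  have C: "?C \<noteq> {}" "?C \<subseteq> verts (EJ_graph \<alpha>)"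
    unfolding EJ_ideal_quot_def EJ_graph_verts using EJ_PIdl_0[of \<beta>] carr by blast+
  have "disjoint_family_on ?B ?C \<longleftrightarrow> ?sep"
  proof
    assume disj: "disjoint_family_on ?B ?C"
    show ?sep
    proof (intro ballI impI)
      fix z w assume z: "z \<in> ej_disc t" and w: "w \<in> ej_disc t"
        and zw: "z - w \<in> PIdl\<^bsub>\<int>[\<rho>]\<^esub> \<beta>"
      \<comment> \<open>The class of \<open>z\<close> lies in two balls: it is at displacement
        \<open>z\<close> from the centre 0 and at displacement \<open>w\<close> from the centre
        \<open>z - w\<close>. Hence these centres coincide.\<close>
      have "EJ_class \<alpha> (0 + z) \<in> ?B (EJ_class \<alpha> 0)"
        using z by (subst graph_ball_EJ_graph) auto
      moreover have "EJ_class \<alpha> (z - w + w) \<in> ?B (EJ_class \<alpha> (z - w))"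
        using w carr[OF zw] by (subst graph_ball_EJ_graph) blast+
      moreover have "EJ_class \<alpha> 0 \<in> ?C" "EJ_class \<alpha> (z - w) \<in> ?C"
        using zw by (auto simp: EJ_ideal_quot_def)
      ultimately have "EJ_class \<alpha> (z - w) = EJ_class \<alpha> 0"
        using disj unfolding disjoint_family_on_def by auto
      then have "z - w \<in> PIdl\<^bsub>\<int>[\<rho>]\<^esub> \<alpha>"
        using carr[OF zw] by (subst (asm) EJ_class_eq_iff) auto
      then show "z = w"
        using small[of "z - w"] ej_disc_diff[OF z w] by simp
    qed
  next
    assume sep: ?sep
    show "disjoint_family_on ?B ?C"
      unfolding disjoint_family_on_def
    proof (intro ballI impI, rule ccontr)
      fix c c' assume c: "c \<in> ?C" "c' \<in> ?C" "c \<noteq> c'" "?B c \<inter> ?B c' \<noteq> {}"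
      obtain z z' where z: "z \<in> PIdl\<^bsub>\<int>[\<rho>]\<^esub> \<beta>" "c = EJ_class \<alpha> z" 
        and z': "z' \<in> PIdl\<^bsub>\<int>[\<rho>]\<^esub> \<beta>" "c' = EJ_class \<alpha> z'"
        using c(1,2) by (auto simp: EJ_ideal_quot_def)
      obtain d d' where d: "d \<in> ej_disc t" "d' \<in> ej_disc t"
        and "EJ_class \<alpha> (z + d) = EJ_class \<alpha> (z' + d')"
        using c(4) unfolding z z' by (auto simp: graph_ball_EJ_graph carr z(1) z'(1))
      then have *: "z + d - (z' + d') \<in> PIdl\<^bsub>\<int>[\<rho>]\<^esub> \<alpha>"
        by (subst (asm) EJ_class_eq_iff) (auto simp: carr z(1) z'(1))
      \<comment> \<open>Removing the difference of the two centres, which is in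
        \<open>(\<beta>)\<close>, shows that the displacements are congruent modulo \<beta>.\<close>
      have "z + d - (z' + d') - (z - z') \<in> PIdl\<^bsub>\<int>[\<rho>]\<^esub> \<beta>"
        by (rule EJ_PIdl_diff[OF subsetD[OF sub *] EJ_PIdl_diff[OF z(1) z'(1)]])
      then have "d = d'"
        using sep d by (auto simp: algebra_simps)
      then have "c = c'"
        using * unfolding z z' by (subst EJ_class_eq_iff) (auto simp: carr z(1) z'(1))
      with c(3) show False ..
    qed
  qed
  moreover have "(\<Union>c\<in>?C. ?B c) = verts (EJ_graph \<alpha>) \<longleftrightarrow> ?cover"
  proof -
    have Un: "(\<Union>c\<in>?C. ?B c) = (\<Union>z\<in>PIdl\<^bsub>\<int>[\<rho>]\<^esub> \<beta>. (\<lambda>d. EJ_class \<alpha> (z + d)) ` ej_disc t)"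
      by (auto simp: EJ_ideal_quot_def graph_ball_EJ_graph carr)
    have sub_verts: "(\<Union>c\<in>?C. ?B c) \<subseteq> EJ_class \<alpha> ` carrier \<int>[\<rho>]"
      unfolding Un by (auto simp: carr)
    have mem: "EJ_class \<alpha> z \<in> (\<Union>c\<in>?C. ?B c) \<longleftrightarrow>
      (\<exists>w\<in>ej_disc t. z - w \<in> PIdl\<^bsub>\<int>[\<rho>]\<^esub> \<beta>)" if z: "z \<in> carrier \<int>[\<rho>]" for z
    proof
      assume "EJ_class \<alpha> z \<in> (\<Union>c\<in>?C. ?B c)"
      then obtain y d where yd: "y \<in> PIdl\<^bsub>\<int>[\<rho>]\<^esub> \<beta>" "d \<in> ej_disc t"
        "EJ_class \<alpha> z = EJ_class \<alpha> (y + d)"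
        unfolding Un by blast
      then have "z - (y + d) \<in> PIdl\<^bsub>\<int>[\<rho>]\<^esub> \<alpha>"
        using z by (subst (asm) EJ_class_eq_iff) (auto simp: carr)
      then have "z - (y + d) + y \<in> PIdl\<^bsub>\<int>[\<rho>]\<^esub> \<beta>"
        using sub yd(1) by (intro EJ_PIdl_add) auto
      then show "\<exists>w\<in>ej_disc t. z - w \<in> PIdl\<^bsub>\<int>[\<rho>]\<^esub> \<beta>"
        using yd(2) by (auto simp: algebra_simps)
    next
      assume "\<exists>w\<in>ej_disc t. z - w \<in> PIdl\<^bsub>\<int>[\<rho>]\<^esub> \<beta>"
      then obtain w where "w \<in> ej_disc t" "z - w \<in> PIdl\<^bsub>\<int>[\<rho>]\<^esub> \<beta>" by blast
      moreover have "EJ_class \<alpha> z = EJ_class \<alpha> (z - w + w)" by simp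
      ultimately show "EJ_class \<alpha> z \<in> (\<Union>c\<in>?C. ?B c)"
        unfolding Un by blast
    qed
    have "(\<Union>c\<in>?C. ?B c) = verts (EJ_graph \<alpha>) \<longleftrightarrow>
        EJ_class \<alpha> ` carrier \<int>[\<rho>] \<subseteq> (\<Union>c\<in>?C. ?B c)"
      unfolding EJ_graph_verts set_eq_subset using sub_verts by (simp only: simp_thms)
    also have "\<dots> \<longleftrightarrow> (\<forall>z\<in>carrier \<int>[\<rho>]. EJ_class \<alpha> z \<in> (\<Union>c\<in>?C. ?B c))"
      by (rule image_subset_iff)
    also have "\<dots> \<longleftrightarrow> ?cover"
      by (rule ball_cong[OF refl mem])
    finally show ?thesis .
  qed
  ultimately show ?thesis
    unfolding perfect_code_def using C by (simp only: simp_thms)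
qed

end

section \<open>Ideals without short elements, and associates\<close>

text \<open>Serves twice with \<open>n = 2t\<close>: for \<alpha>, of length \<open>a + b\<close>,
  and for the two candidate generators, of length \<open>2t + 1\<close>.\<close>

lemma EJ_PIdl_disc_trivial:
  fixes c d :: int
  assumes "c \<ge> 0" "d \<ge> 0" "int n < c + d"
    and "z \<in> ej_disc n" "z \<in> PIdl\<^bsub>\<int>[\<rho>]\<^esub> (of_int c + of_int d * \<rho>)"
  shows "z = 0"
proof (rule ccontr)
  assume "z \<noteq> 0"
  obtain w where w: "w \<in> carrier \<int>[\<rho>]" "z = w * (of_int c + of_int d * \<rho>)"
    using assms(5) unfolding mem_EJ_PIdl_iff by blast
  with \<open>z \<noteq> 0\<close> have "w \<noteq> 0" by auto
  from mult_notin_ej_disc[OF w(1) this assms(1-3)] assms(4) show False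
    unfolding w(2) by blast
qed

lemma ej_associate_PIdl_subset:
  "ej_associate \<beta> \<beta>' \<Longrightarrow> PIdl\<^bsub>\<int>[\<rho>]\<^esub> \<beta> \<subseteq> PIdl\<^bsub>\<int>[\<rho>]\<^esub> \<beta>'"
  by (rule EJ_PIdl_subset) (auto simp: ej_associate_def intro: EJ_PIdl_mult EJ_PIdl_self)

lemma ej_associate_norm:
  assumes "ej_associate \<beta> \<beta>'" "\<beta>' \<in> carrier \<int>[\<rho>]"
  shows "ej_norm \<beta> = ej_norm \<beta>'"
proof -
  obtain j where j: "\<beta> = \<rho> powi j * \<beta>'"
    using assms(1) by (auto simp: ej_associate_def)
  have "real_of_int (ej_norm \<beta>) = of_int (ej_norm \<beta>')"
    using assms(2) by (simp add: j of_int_ej_norm norm_mult norm_power_int)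
  then show ?thesis by simp
qed

text \<open>The new coordinates are those of the product with \<rho>, a rotation by 60 degrees, so
  the exponent of \<rho> grows by one.\<close>

lemma ej_associate_rotate:
  assumes "ej_associate (of_int x + of_int y * \<rho>) \<beta>"
  shows "ej_associate (of_int (- y) + of_int (x + y) * \<rho>) \<beta>"
proof -
  obtain j where j: "of_int x + of_int y * \<rho> = \<rho> powi j * \<beta>"
    using assms by (auto simp: ej_associate_def)
  have "\<rho> \<noteq> 0"
    using cmod_rho by force
  have "of_int (- y) + of_int (x + y) * \<rho> = \<rho> * (of_int x + of_int y * \<rho>)"
    by (simp add: algebra_simps ej_rho_mult_rho)
  also have "\<dots> = \<rho> powi (j + 1) * \<beta>"
    using \<open>\<rho> \<noteq> 0\<close> by (simp add: j power_int_add_1')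
  finally show ?thesis
    unfolding ej_associate_def by blast
qed

lemma ej_associate_coords:
  assumes "(x, y) \<in> {(u, v), (- v, u + v), (- u - v, u), (- u, - v), (v, - u - v), (u + v, - u)}"
  shows "ej_associate (of_int x + of_int y * \<rho>) (of_int u + of_int v * \<rho>)"
proof -
  \<comment> \<open>\<open>A\<close> keeps the coordinates as integer arguments; simplification then
    normalises them instead of the complex expression.\<close>
  define A where "A p q \<longleftrightarrow> ej_associate (of_int p + of_int q * \<rho>) (of_int u + of_int v * \<rho>)" for p q
  have rotate: "A (- q) (p + q)" if "A p q" for p q
    using that ej_associate_rotate unfolding A_def by blast
  have "A u v"
    unfolding A_def ej_associate_def by (rule exI[of _ 0]) simp
  moreover from rotate[OF this] have "A (- v) (u + v)" .
  moreover from rotate[OF this] have "A (- u - v) u" by simp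
  moreover from rotate[OF this] have "A (- u) (- v)" by simp
  moreover from rotate[OF this] have "A v (- u - v)" by simp
  moreover from rotate[OF this] have "A (u + v) (- u)" by (simp add: add.commute)
  ultimately have "A x y"
    using assms by auto
  then show ?thesis
    by (simp only: A_def)
qed

section \<open>Elements of norm \<open>3t\<^sup>2 + 3t + 1\<close>\<close>

text \<open>Already \<open>\<bar>p\<bar> = s + 1\<close> would raise the left-hand side by
  \<open>6 * s + 3\<close>, more than the 1 available.\<close>

lemma three_squares_add_square_eq:
  fixes p q s :: int
  assumes "3 * p\<^sup>2 + q\<^sup>2 = 3 * s\<^sup>2 + 1" "0 < s" "s \<le> \<bar>p\<bar>"
  shows "\<bar>p\<bar> = s" "\<bar>q\<bar> = 1"
proof -
  have "\<not> s + 1 \<le> \<bar>p\<bar>"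
  proof
    assume "s + 1 \<le> \<bar>p\<bar>"
    then have "(s + 1)\<^sup>2 \<le> \<bar>p\<bar>\<^sup>2"
      using assms(2) by (intro power_mono) auto
    then have "s\<^sup>2 + 2 * s + 1 \<le> p\<^sup>2"
      by (simp add: power2_sum)
    then show False
      using assms(1,2) zero_le_power2[of q] by linarith
  qed
  with assms(3) show p: "\<bar>p\<bar> = s" by simp
  have "p\<^sup>2 = s\<^sup>2"
    by (simp add: p[symmetric])
  with assms(1) have "q\<^sup>2 = 1" by simp
  then show "\<bar>q\<bar> = 1"
    by (auto simp: power2_eq_1_iff)
qed

text \<open>Four times the norm is \<open>3 * p\<^sup>2 + q\<^sup>2\<close> with \<open>p\<close>
  any of \<open>x\<close>, \<open>y\<close>, \<open>x + y\<close>. By \<open>big\<close> one of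
  these choices has \<open>\<bar>p\<bar> \<ge> 2 * t + 1\<close>, so \<open>p\<close> and
  \<open>q\<close> are known up to sign. The twelve solutions are listed as the orbits of
  \<open>(t + 1, t)\<close> and \<open>(t, t + 1)\<close> under rotation, in the order of
  \<open>ej_associate_coords\<close>.\<close>

lemma norm_eq_card_disc_cases:
  fixes x y t :: int
  assumes norm: "x\<^sup>2 + x * y + y\<^sup>2 = 3 * t\<^sup>2 + 3 * t + 1" and "0 \<le> t"
    and big: "\<not> (\<bar>x\<bar> \<le> 2 * t \<and> \<bar>y\<bar> \<le> 2 * t \<and> \<bar>x + y\<bar> \<le> 2 * t)"
  shows "(x, y) \<in> {(t + 1, t), (- t, 2 * t + 1), (- 2 * t - 1, t + 1),
      (- t - 1, - t), (t, - 2 * t - 1), (2 * t + 1, - t - 1)} \<or>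
    (x, y) \<in> {(t, t + 1), (- t - 1, 2 * t + 1), (- 2 * t - 1, t),
      (- t, - t - 1), (t + 1, - 2 * t - 1), (2 * t + 1, - t)}"
proof -
  define s where "s = 2 * t + 1"
  have "0 < s"
    using \<open>0 \<le> t\<close> by (simp add: s_def)
  have "4 * (x\<^sup>2 + x * y + y\<^sup>2) = 3 * s\<^sup>2 + 1"
    unfolding norm by (simp add: s_def power2_eq_square algebra_simps)
  then have eqs: "3 * x\<^sup>2 + (x + 2 * y)\<^sup>2 = 3 * s\<^sup>2 + 1"
      "3 * y\<^sup>2 + (2 * x + y)\<^sup>2 = 3 * s\<^sup>2 + 1" "3 * (x + y)\<^sup>2 + (x - y)\<^sup>2 = 3 * s\<^sup>2 + 1"
    by (simp_all add: power2_eq_square algebra_simps)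
  consider "s \<le> \<bar>x\<bar>" | "s \<le> \<bar>y\<bar>" | "s \<le> \<bar>x + y\<bar>"
    using big unfolding s_def by linarith
  then show ?thesis
  proof cases
    case 1
    with three_squares_add_square_eq[OF eqs(1) \<open>0 < s\<close>]
    consider "x = 2 * t + 1" "y = - t"
      | "x = 2 * t + 1" "y = - t - 1"
      | "x = - 2 * t - 1" "y = t + 1"
      | "x = - 2 * t - 1" "y = t"
      unfolding s_def by (smt (verit))
    then show ?thesis
      by cases simp_all
  next
    case 2
    with three_squares_add_square_eq[OF eqs(2) \<open>0 < s\<close>]
    consider "x = - t" "y = 2 * t + 1"
      | "x = - t - 1" "y = 2 * t + 1"
      | "x = t + 1" "y = - 2 * t - 1"
      | "x = t" "y = - 2 * t - 1"
      unfolding s_def by (smt (verit))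
    then show ?thesis
      by cases simp_all
  next
    case 3
    with three_squares_add_square_eq[OF eqs(3) \<open>0 < s\<close>]
    consider "x = t + 1" "y = t"
      | "x = t" "y = t + 1"
      | "x = - t - 1" "y = - t"
      | "x = - t" "y = - t - 1"
      unfolding s_def by (smt (verit))
    then show ?thesis
      by cases simp_all
  qed
qed

theorem theorem4p7:
  fixes a b :: int and \<alpha> \<beta> :: complex and t :: nat
  assumes "\<alpha> = of_int a + of_int b * \<rho>" and "a \<ge> 0" and "b \<ge> 0" and "\<alpha> \<noteq> 0"
    and "\<beta> \<in> carrier \<int>[\<rho>]" and "\<beta> \<noteq> 0"
    and "ej_norm \<alpha> \<ge> 7"
    and "\<beta> divides\<^bsub>\<int>[\<rho>]\<^esub> \<alpha>"
    and "1 \<le> t" and "int t \<le> \<lfloor>(of_int (a + b - 1) :: real) / 2\<rfloor>"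
  shows "perfect_code (EJ_graph \<alpha>) t (EJ_ideal_quot \<beta> \<alpha>) \<longleftrightarrow>
    ej_associate \<beta> (of_nat (t + 1) + of_nat t * \<rho>) \<or>
    ej_associate \<beta> (of_nat t + of_nat (t + 1) * \<rho>)"
proof -
  let ?sep = "\<forall>z\<in>ej_disc t. \<forall>w\<in>ej_disc t. z - w \<in> PIdl\<^bsub>\<int>[\<rho>]\<^esub> \<beta> \<longrightarrow> z = w"
  let ?cover = "\<forall>z\<in>carrier \<int>[\<rho>]. \<exists>w\<in>ej_disc t. z - w \<in> PIdl\<^bsub>\<int>[\<rho>]\<^esub> \<beta>"
  let ?N = "int (3 * t\<^sup>2 + 3 * t + 1)"
  have \<alpha>: "\<alpha> \<in> carrier \<int>[\<rho>]"
    by (simp add: assms(1))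
  \<comment> \<open>The floor bound amounts to \<open>2t < a + b\<close>: differences of two disc
    elements are shorter than \<alpha>.\<close>
  have "real t \<le> of_int (a + b - 1) / 2"
    using assms(10) by (simp only: le_floor_iff of_int_of_nat_eq)
  then have "real_of_int (2 * int t) \<le> of_int (a + b - 1)"
    by simp
  then have "2 * int t \<le> a + b - 1"
    by (simp only: of_int_le_iff)
  then have "int (t + t) < a + b"
    by simp
  then have small: "z = 0" if "z \<in> ej_disc (t + t)" "z \<in> PIdl\<^bsub>\<int>[\<rho>]\<^esub> \<alpha>" for z
    by (rule EJ_PIdl_disc_trivial[OF assms(2,3) _ that[unfolded assms(1)]])
  have \<alpha>\<beta>: "\<alpha> \<in> PIdl\<^bsub>\<int>[\<rho>]\<^esub> \<beta>"
    using assms(8) by (auto simp: factor_def mem_EJ_PIdl_iff mult.commute)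
  have perfect: "perfect_code (EJ_graph \<alpha>) t (EJ_ideal_quot \<beta> \<alpha>) \<longleftrightarrow> ?sep \<and> ?cover"
    by (rule perfect_code_EJ_iff[OF \<alpha> assms(5) \<alpha>\<beta> small])
  have cover_iff: "?cover \<longleftrightarrow> ej_norm \<beta> = ?N" if ?sep
    by (rule ej_disc_cover_iff_norm[OF assms(5,6) that[rule_format]])
  show ?thesis
  proof
    assume "perfect_code (EJ_graph \<alpha>) t (EJ_ideal_quot \<beta> \<alpha>)"
    note code = iffD1[OF perfect this]
    note sep = conjunct1[OF code]
    have norm: "ej_norm \<beta> = ?N"
      by (rule iffD1[OF cover_iff[OF sep] conjunct2[OF code]])
    obtain x y where \<beta>: "\<beta> = of_int x + of_int y * \<rho>"
      using assms(5) by (auto simp: EJ_carrier_iff)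
    \<comment> \<open>Otherwise \<beta> would be a difference of two disc elements, which are
      congruent modulo \<beta> and hence equal by \<open>sep\<close>.\<close>
    have "\<beta> \<notin> ej_disc (t + t)"
    proof
      assume "\<beta> \<in> ej_disc (t + t)"
      from ej_disc_split[OF this] obtain v w
        where vw: "v \<in> ej_disc t" "w \<in> ej_disc t" "\<beta> = v - w"
        by (elim bexE)
      have "v = w"
        by (rule sep[rule_format, OF vw(1,2)]) (simp only: vw(3)[symmetric] EJ_PIdl_self)
      with vw(3) \<open>\<beta> \<noteq> 0\<close> show False by simp
    qed
    then have big: "\<not> (\<bar>x\<bar> \<le> 2 * int t \<and> \<bar>y\<bar> \<le> 2 * int t \<and> \<bar>x + y\<bar> \<le> 2 * int t)"
      by (simp add: \<beta> ej_disc_iff)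
    have "x\<^sup>2 + x * y + y\<^sup>2 = 3 * (int t)\<^sup>2 + 3 * int t + 1"
      using norm by (simp add: \<beta> ej_norm_eq)
    from norm_eq_card_disc_cases[OF this of_nat_0_le_iff big] consider
      "(x, y) \<in> {(int t + 1, int t), (- int t, 2 * int t + 1), (- 2 * int t - 1, int t + 1),
        (- int t - 1, - int t), (int t, - 2 * int t - 1), (2 * int t + 1, - int t - 1)}" |
      "(x, y) \<in> {(int t, int t + 1), (- int t - 1, 2 * int t + 1), (- 2 * int t - 1, int t),
        (- int t, - int t - 1), (int t + 1, - 2 * int t - 1), (2 * int t + 1, - int t)}"
      by (rule disjE)
    then show "ej_associate \<beta> (of_nat (t + 1) + of_nat t * \<rho>) \<or>
      ej_associate \<beta> (of_nat t + of_nat (t + 1) * \<rho>)"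
    proof cases
      case 1
      have "ej_associate \<beta> (of_int (int t + 1) + of_int (int t) * \<rho>)"
        unfolding \<beta> by (rule ej_associate_coords) (use 1 in auto)
      then show ?thesis
        by (simp add: add.commute)
    next
      case 2
      have "ej_associate \<beta> (of_int (int t) + of_int (int t + 1) * \<rho>)"
        unfolding \<beta> by (rule ej_associate_coords) (use 2 in auto)
      then show ?thesis
        by (simp add: add.commute)
    qed
  next
    have code: "perfect_code (EJ_graph \<alpha>) t (EJ_ideal_quot \<beta> \<alpha>)"
      if cd: "(c, d) \<in> {(int t + 1, int t), (int t, int t + 1)}"
        and assoc: "ej_associate \<beta> (of_int c + of_int d * \<rho>)" for c d
    proof -
      \<comment> \<open>Both candidates have \<open>c + d = 2t + 1\<close>, one more than the
        largest length of a difference of two disc elements.\<close>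
      have nonneg: "0 \<le> c" "0 \<le> d" "int (t + t) < c + d"
        using cd by auto
      have sep: ?sep
      proof (intro ballI impI)
        fix z w assume zw: "z \<in> ej_disc t" "w \<in> ej_disc t" "z - w \<in> PIdl\<^bsub>\<int>[\<rho>]\<^esub> \<beta>"
        have "z - w = 0"
          by (rule EJ_PIdl_disc_trivial[OF nonneg ej_disc_diff[OF zw(1,2)]
                subsetD[OF ej_associate_PIdl_subset[OF assoc] zw(3)]])
        then show "z = w" by simp
      qed
      have "ej_norm \<beta> = c\<^sup>2 + c * d + d\<^sup>2"
        using ej_associate_norm[OF assoc] by (simp add: ej_norm_eq)
      also have "\<dots> = ?N"
        using cd by (auto simp: power2_eq_square algebra_simps)
      finally show ?thesis
        by (intro iffD2[OF perfect] conjI sep iffD2[OF cover_iff[OF sep]])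
    qed
    assume "ej_associate \<beta> (of_nat (t + 1) + of_nat t * \<rho>) \<or>
      ej_associate \<beta> (of_nat t + of_nat (t + 1) * \<rho>)"
    then show "perfect_code (EJ_graph \<alpha>) t (EJ_ideal_quot \<beta> \<alpha>)"
      using code[of "int t + 1" "int t"] code[of "int t" "int t + 1"] by (auto simp: add.commute)
  qed
qed

end
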